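(* Let $r \in \mathbb{N}$ and let $K \subset \mathbb{Z}^r$. If $K$ is ubiquitous, then $K$ is strictly positive definite.
   Context: $\mathbb{Z}^r$ is regarded as the dual group of $\mathbb{T}^r$ via $\gamma(z) = \prod_{k=1}^r z_k^{\gamma_k}$. A trigonometric polynomial on $\mathbb{Z}^r$ is a function of the form $\gamma \mapsto \sum_{i=1}^n c_i \gamma(x_i)$ with $x_i \in \mathbb{T}^r$, $c_i \in \mathbb{C}$. A subset $K \subset \mathbb{Z}^r$ is strictly positive definite if the only trigonometric polynomial vanishing at every point of $K$ is the identically zero function. $K$ is ubiquitous if for every subgroup $H$ of $\mathbb{Z}^r$ of finite index and every $\gamma \in \mathbb{Z}^r$ the coset $\gamma + H$ meets $K$. *)

theory Defs
  imports Complex_Main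
begin

definition Zr :: "nat \<Rightarrow> (nat \<Rightarrow> int) set" where
  "Zr r = {\<gamma>. \<forall>k\<ge>r. \<gamma> k = 0}"

definition Tr :: "nat \<Rightarrow> (nat \<Rightarrow> complex) set" where
  "Tr r = {z. (\<forall>k<r. cmod (z k) = 1) \<and> (\<forall>k\<ge>r. z k = 1)}"

definition chr :: "nat \<Rightarrow> (nat \<Rightarrow> int) \<Rightarrow> (nat \<Rightarrow> complex) \<Rightarrow> complex" where
  "chr r \<gamma> z = (\<Prod>k<r. z k powi \<gamma> k)"

definition trig_poly :: "nat \<Rightarrow> nat \<Rightarrow> (nat \<Rightarrow> complex) \<Rightarrow> (nat \<Rightarrow> nat \<Rightarrow> complex)
    \<Rightarrow> (nat \<Rightarrow> int) \<Rightarrow> complex" where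
  "trig_poly r n c x \<gamma> = (\<Sum>i<n. c i * chr r \<gamma> (x i))"

definition strictly_pos_def :: "nat \<Rightarrow> (nat \<Rightarrow> int) set \<Rightarrow> bool" where
  "strictly_pos_def r K \<longleftrightarrow>
     (\<forall>n c x. (\<forall>i<n. x i \<in> Tr r) \<longrightarrow> (\<forall>\<gamma>\<in>K. trig_poly r n c x \<gamma> = 0)
        \<longrightarrow> (\<forall>\<gamma>\<in>Zr r. trig_poly r n c x \<gamma> = 0))"

definition coset :: "(nat \<Rightarrow> int) \<Rightarrow> (nat \<Rightarrow> int) set \<Rightarrow> (nat \<Rightarrow> int) set" where
  "coset \<gamma> H = {(\<lambda>k. \<gamma> k + h k) | h. h \<in> H}"

definition subgroup_Zr :: "nat \<Rightarrow> (nat \<Rightarrow> int) set \<Rightarrow> bool" where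
  "subgroup_Zr r H \<longleftrightarrow> H \<subseteq> Zr r \<and> (\<lambda>k. 0) \<in> H \<and>
     (\<forall>a\<in>H. \<forall>b\<in>H. (\<lambda>k. a k + b k) \<in> H) \<and> (\<forall>a\<in>H. (\<lambda>k. - a k) \<in> H)"

definition finite_index :: "nat \<Rightarrow> (nat \<Rightarrow> int) set \<Rightarrow> bool" where
  "finite_index r H \<longleftrightarrow> finite ((\<lambda>\<gamma>. coset \<gamma> H) ` Zr r)"

definition ubiquitous :: "nat \<Rightarrow> (nat \<Rightarrow> int) set \<Rightarrow> bool" where
  "ubiquitous r K \<longleftrightarrow> (\<forall>H. subgroup_Zr r H \<and> finite_index r H \<longrightarrow>
     (\<forall>\<gamma>\<in>Zr r. coset \<gamma> H \<inter> K \<noteq> {}))"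

end

theory Submission
  imports Defs "HOL-Computational_Algebra.Polynomial"
begin

text \<open>Suppose a trigonometric polynomial f does not vanish at a point \<open>\<gamma>\<close>. Its coefficients and
  the coordinates of its nodes, together with their inverses, generate a subring A of the complex
  numbers that is finitely generated over the integers. By a form of Hilbert's Nullstellensatz
  over the integers, the nonzero element \<open>f \<gamma>\<close> of A is invertible modulo a proper ideal I of
  finite index. Modulo I each character has finite order, so the \<open>\<delta>\<close> at which all characters
  involved are 1 modulo I form a subgroup H of finite index, and f is constant modulo I on cosets
  of H. Thus f has no zero on \<open>\<gamma> + H\<close>, although this coset meets K.\<close>

section \<open>Subrings, ideals and finite residue systems\<close>

definition is_subring :: "'a::comm_ring_1 set \<Rightarrow> bool" where
  "is_subring A \<longleftrightarrow> 1 \<in> A \<and> (\<forall>x\<in>A. \<forall>y\<in>A. x - y \<in> A \<and> x * y \<in> A)"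

definition is_ideal :: "'a::comm_ring_1 set \<Rightarrow> 'a set \<Rightarrow> bool" where
  "is_ideal I A \<longleftrightarrow> I \<subseteq> A \<and> 0 \<in> I \<and> (\<forall>x\<in>I. \<forall>y\<in>I. x - y \<in> I) \<and> (\<forall>a\<in>A. \<forall>x\<in>I. a * x \<in> I)"

text \<open>Finite index is expressed by a finite system of representatives, possibly redundant, so
  that no quotient ring has to be formed.\<close>

definition finite_residues :: "'a::comm_ring_1 set \<Rightarrow> 'a set \<Rightarrow> bool" where
  "finite_residues I A \<longleftrightarrow> (\<exists>F. finite F \<and> F \<subseteq> A \<and> (\<forall>x\<in>A. \<exists>f\<in>F. x - f \<in> I))"

text \<open>For a subring \<open>A\<close> this says that each nonzero element avoids some maximal
  ideal with finite residue field. Asking for invertibility modulo a proper ideal of finite index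
  avoids maximal ideals, and in this form the property passes from \<open>A\<close> to A[t].\<close>

definition finite_quotients_detect_nonzero :: "'a::comm_ring_1 set \<Rightarrow> bool" where
  "finite_quotients_detect_nonzero A \<longleftrightarrow>
     (\<forall>a\<in>A. a \<noteq> 0 \<longrightarrow>
        (\<exists>I. is_ideal I A \<and> 1 \<notin> I \<and> finite_residues I A \<and> (\<exists>u\<in>A. a * u - 1 \<in> I)))"

text \<open>No closure of \<open>A\<close> is required, because the same operator is applied to an
  ideal \<open>I\<close> of \<open>A\<close>, where it gives the ideal I[X] of A[X].\<close>

definition polys_over :: "'a::zero set \<Rightarrow> 'a poly set" where
  "polys_over A = {p. \<forall>i. coeff p i \<in> A}"

definition adjoin :: "'a::comm_ring_1 set \<Rightarrow> 'a \<Rightarrow> 'a set" where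
  "adjoin A t = (\<lambda>p. poly p t) ` polys_over A"

lemma subring_one: "is_subring A \<Longrightarrow> 1 \<in> A"
  and subring_diff: "is_subring A \<Longrightarrow> x \<in> A \<Longrightarrow> y \<in> A \<Longrightarrow> x - y \<in> A"
  and subring_mult: "is_subring A \<Longrightarrow> x \<in> A \<Longrightarrow> y \<in> A \<Longrightarrow> x * y \<in> A"
  by (auto simp: is_subring_def)

lemma subring_zero: "is_subring A \<Longrightarrow> 0 \<in> A"
  using subring_diff[of A 1 1] subring_one by auto

lemma subring_uminus: "is_subring A \<Longrightarrow> x \<in> A \<Longrightarrow> - x \<in> A"
  using subring_diff[of A 0 x] subring_zero by auto

lemma subring_add: "is_subring A \<Longrightarrow> x \<in> A \<Longrightarrow> y \<in> A \<Longrightarrow> x + y \<in> A"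
  using subring_diff[of A x "- y"] subring_uminus by auto

lemma subring_power: "is_subring A \<Longrightarrow> x \<in> A \<Longrightarrow> x ^ n \<in> A"
  by (induction n) (auto simp: subring_one subring_mult)

lemma subring_sum: "is_subring A \<Longrightarrow> (\<And>i. i \<in> S \<Longrightarrow> f i \<in> A) \<Longrightarrow> sum f S \<in> A"
  by (induction S rule: infinite_finite_induct) (auto simp: subring_zero subring_add)

lemma subring_prod: "is_subring A \<Longrightarrow> (\<And>i. i \<in> S \<Longrightarrow> f i \<in> A) \<Longrightarrow> prod f S \<in> A"
  by (induction S rule: infinite_finite_induct) (auto simp: subring_one subring_mult)

lemmas subring_closed =
  subring_one subring_zero subring_diff subring_mult subring_uminus subring_add
  subring_power subring_sum subring_prod

lemma ideal_subset: "is_ideal I A \<Longrightarrow> x \<in> I \<Longrightarrow> x \<in> A"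
  and ideal_zero: "is_ideal I A \<Longrightarrow> 0 \<in> I"
  and ideal_diff: "is_ideal I A \<Longrightarrow> x \<in> I \<Longrightarrow> y \<in> I \<Longrightarrow> x - y \<in> I"
  and ideal_mult: "is_ideal I A \<Longrightarrow> a \<in> A \<Longrightarrow> x \<in> I \<Longrightarrow> a * x \<in> I"
  by (auto simp: is_ideal_def)

lemma ideal_mult_right: "is_ideal I A \<Longrightarrow> a \<in> A \<Longrightarrow> x \<in> I \<Longrightarrow> x * a \<in> I"
  by (metis ideal_mult mult.commute)

lemma ideal_uminus: "is_ideal I A \<Longrightarrow> x \<in> I \<Longrightarrow> - x \<in> I"
  using ideal_diff[of I A 0 x] ideal_zero by auto

lemma ideal_add: "is_ideal I A \<Longrightarrow> x \<in> I \<Longrightarrow> y \<in> I \<Longrightarrow> x + y \<in> I"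
  using ideal_diff[of I A x "- y"] ideal_uminus by auto

lemma ideal_sum: "is_ideal I A \<Longrightarrow> (\<And>i. i \<in> S \<Longrightarrow> f i \<in> I) \<Longrightarrow> sum f S \<in> I"
  by (induction S rule: infinite_finite_induct) (auto simp: ideal_zero ideal_add)

lemma ideal_power_unit:
  assumes "is_subring A" "is_ideal I A" "x \<in> A" "x - 1 \<in> I"
  shows "x ^ n - 1 \<in> I"
proof (induction n)
  case (Suc n)
  have "x ^ Suc n - 1 = x * (x ^ n - 1) + (x - 1)" by (simp add: algebra_simps)
  with Suc show ?case using assms by (metis ideal_add ideal_mult)
qed (use assms in \<open>auto simp: ideal_zero\<close>)

section \<open>Polynomials over a subring and adjunction of an element\<close>

lemma subring_polys_over:
  assumes "is_subring A" shows "is_subring (polys_over A)"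
  unfolding is_subring_def
proof (intro conjI ballI)
  show "1 \<in> polys_over A"
    using assms by (auto simp: polys_over_def coeff_pCons one_pCons subring_closed split: nat.splits)
next
  fix p q assume pq: "p \<in> polys_over A" "q \<in> polys_over A"
  then show "p - q \<in> polys_over A"
    using assms by (auto simp: polys_over_def subring_closed)
  from pq show "p * q \<in> polys_over A"
    using assms by (auto simp: polys_over_def coeff_mult intro!: subring_sum subring_mult)
qed

lemma ideal_polys_over:
  assumes "is_ideal I A" shows "is_ideal (polys_over I) (polys_over A)"
  unfolding is_ideal_def[of "polys_over I"]
proof (intro conjI ballI)
  show "polys_over I \<subseteq> polys_over A" using ideal_subset[OF assms] by (auto simp: polys_over_def)
  show "0 \<in> polys_over I" using ideal_zero[OF assms] by (auto simp: polys_over_def)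
next
  fix p q assume "p \<in> polys_over I" "q \<in> polys_over I"
  then show "p - q \<in> polys_over I" using ideal_diff[OF assms] by (auto simp: polys_over_def)
next
  fix a p assume "a \<in> polys_over A" "p \<in> polys_over I"
  then show "a * p \<in> polys_over I"
    by (auto simp: polys_over_def coeff_mult intro!: ideal_sum[OF assms] ideal_mult[OF assms])
qed

lemma const_polys_over: "0 \<in> A \<Longrightarrow> c \<in> A \<Longrightarrow> [:c:] \<in> polys_over A"
  by (auto simp: polys_over_def coeff_pCons split: nat.splits)

lemma monom_polys_over: "0 \<in> A \<Longrightarrow> c \<in> A \<Longrightarrow> monom c n \<in> polys_over A"
  by (auto simp: polys_over_def)

lemma subring_adjoin:
  assumes "is_subring A" shows "is_subring (adjoin A t)"
proof -
  note P = subring_polys_over[OF assms]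
  show ?thesis unfolding is_subring_def adjoin_def
    using subring_one[OF P] subring_diff[OF P] subring_mult[OF P]
    by (auto simp: image_iff) (metis poly_1, metis poly_diff, metis poly_mult)
qed

lemma subset_adjoin:
  assumes "is_subring A" shows "A \<subseteq> adjoin A t"
proof
  fix x assume "x \<in> A"
  then have "[:x:] \<in> polys_over A" using assms by (simp add: const_polys_over subring_zero)
  then show "x \<in> adjoin A t" unfolding adjoin_def by (intro image_eqI[where x = "[:x:]"]) auto
qed

lemma mem_adjoin:
  assumes "is_subring A" shows "t \<in> adjoin A t"
proof -
  have "monom 1 1 \<in> polys_over A" using assms by (simp add: monom_polys_over subring_closed)
  then show ?thesis unfolding adjoin_def
    by (intro image_eqI[where x = "monom 1 1"]) (auto simp: poly_monom)
qed

section \<open>Division when the leading coefficient is not a unit\<close>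

text \<open>The leading coefficient of \<open>g\<close> need not be invertible in \<open>A\<close>,
  so each step of the long division costs one factor \<open>lead_coeff g\<close>; these factors
  accumulate in the power \<open>N\<close>.\<close>

lemma pseudo_division_over_subring:
  fixes g :: "'a::idom poly"
  assumes A: "is_subring A" and g: "g \<in> polys_over A" "degree g \<ge> 1"
    and p: "p \<in> polys_over A"
  shows "\<exists>N s r. s \<in> polys_over A \<and> r \<in> polys_over A \<and> degree r < degree g \<and>
           [:lead_coeff g ^ N:] * p = s * g + r"
  using p
proof (induction "degree p" arbitrary: p rule: less_induct)
  case less
  note P = subring_polys_over[OF A]
  show ?case
  proof (cases "degree p < degree g")
    case True
    then show ?thesis
      using less.prems subring_zero[OF P] by (intro exI[of _ 0] exI[of _ 0] exI[of _ p]) simp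
  next
    case False
    \<comment> \<open>Both \<open>[:lead_coeff g:] * p\<close> and \<open>m * g\<close> have the
      coefficient \<open>lead_coeff g * lead_coeff p\<close> at \<open>degree p\<close>, so it
      cancels in \<open>p'\<close>.\<close>
    define m where "m = monom (lead_coeff p) (degree p - degree g)"
    define p' where "p' = [:lead_coeff g:] * p - m * g"
    have lg: "lead_coeff g \<in> A" and lp: "lead_coeff p \<in> A"
      using g less.prems by (auto simp: polys_over_def)
    have m: "m \<in> polys_over A"
      unfolding m_def using A lp by (simp add: monom_polys_over subring_closed)
    have clg: "[:lead_coeff g ^ k:] \<in> polys_over A" for k
      using A lg by (simp add: const_polys_over subring_closed)
    have p': "p' \<in> polys_over A"
      unfolding p'_def using clg[of 1] less.prems m g
      by (intro subring_diff[OF P] subring_mult[OF P]) simp_all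
    have pn: "p \<noteq> 0" and gn: "g \<noteq> 0" using False g by auto
    have "degree (m * g) \<le> degree p"
      using degree_mult_le[of m g] degree_monom_le[of "lead_coeff p" "degree p - degree g"] False
      unfolding m_def by linarith
    moreover have "degree ([:lead_coeff g:] * p) \<le> degree p"
      using degree_mult_le[of "[:lead_coeff g:]" p] by simp
    ultimately have "degree p' \<le> degree p" unfolding p'_def by (rule degree_diff_le[rotated])
    moreover have "coeff p' (degree p) = 0"
      using False unfolding p'_def m_def
      by (simp add: coeff_monom_mult)
    \<comment> \<open>Here \<open>degree p\<close> is positive, so the degree drops strictly even if
      \<open>p'\<close> is zero.\<close>
    ultimately have "degree p' < degree p"
      using False g by (metis coeff_0 degree_0 eq_zero_or_degree_less gr0I le_0_eq linorder_not_le not_one_le_zero)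
    from less.hyps[OF this p'] obtain N s r where
      sr: "s \<in> polys_over A" "r \<in> polys_over A" "degree r < degree g"
          "[:lead_coeff g ^ N:] * p' = s * g + r" by blast
    have "[:lead_coeff g ^ Suc N:] = [:lead_coeff g ^ N:] * [:lead_coeff g:]" by simp
    then have "[:lead_coeff g ^ Suc N:] * p = [:lead_coeff g ^ N:] * (p' + m * g)"
      unfolding p'_def by (simp only: mult.assoc) simp
    also have "\<dots> = (s + [:lead_coeff g ^ N:] * m) * g + r"
      unfolding distrib_left sr(4) by (simp only: algebra_simps)
    finally show ?thesis
      using sr(1-3) subring_add[OF P sr(1) subring_mult[OF P clg m]] by blast
  qed
qed

section \<open>Extending an ideal of finite index from A to A[t]\<close>

text \<open>Modulo \<open>I\<close> the leading coefficient of \<open>g\<close> is a unit, so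
  multiplication by \<open>g\<close> raises the degree of every polynomial that is nonzero modulo
  \<open>I\<close> by \<open>degree g\<close>, and the product cannot be constant. The induction
  removes the top term of \<open>h\<close>, which is shown to lie in I[X].\<close>

lemma multiple_congruent_const_imp_zero:
  fixes g :: "'a::idom poly"
  assumes A: "is_subring A" and I: "is_ideal I A" and g: "g \<in> polys_over A" "degree g \<ge> 1"
    and u: "u \<in> A" "lead_coeff g * u - 1 \<in> I"
    and h: "h \<in> polys_over A" "h * g - [:c:] \<in> polys_over I"
  shows "h \<in> polys_over I"
  using h
proof (induction "degree h" arbitrary: h rule: less_induct)
  case less
  note PI = ideal_polys_over[OF I]
  have lh: "lead_coeff h \<in> A" using less.prems by (auto simp: polys_over_def)
  \<comment> \<open>The index is at least 1, so the constant \<open>c\<close> does not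
    contribute.\<close>
  have "coeff (h * g - [:c:]) (degree h + degree g) = lead_coeff h * lead_coeff g"
    using g coeff_mult_degree_sum[of h g] by (auto simp: coeff_pCons split: nat.splits)
  then have "lead_coeff h * lead_coeff g \<in> I"
    using less.prems(2) unfolding polys_over_def by (metis mem_Collect_eq)
  \<comment> \<open>The difference equals \<open>lead_coeff h\<close>: multiplying by
    \<open>u\<close> undoes \<open>lead_coeff g\<close> modulo \<open>I\<close>.\<close>
  then have "u * (lead_coeff h * lead_coeff g) - lead_coeff h * (lead_coeff g * u - 1) \<in> I"
    by (rule ideal_diff[OF I ideal_mult[OF I u(1)] ideal_mult[OF I lh u(2)]])
  then have lhI: "lead_coeff h \<in> I" by (simp add: algebra_simps)
  define m where "m = monom (lead_coeff h) (degree h)"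
  have m: "m \<in> polys_over I" unfolding m_def using lhI I by (simp add: monom_polys_over ideal_zero)
  show ?case
  proof (cases "degree h = 0")
    case True
    then have "h = m" unfolding m_def by (metis degree_0_id monom_0 of_nat_0 degree_eq_zeroE coeff_pCons_0)
    with m show ?thesis by simp
  next
    case False
    have "degree (h - m) \<le> degree h" unfolding m_def
      by (intro degree_diff_le) (auto simp: degree_monom_le)
    moreover have "coeff (h - m) (degree h) = 0" unfolding m_def by simp
    ultimately have "degree (h - m) < degree h"
      using False by (metis degree_0 eq_zero_or_degree_less not_gr0)
    moreover have "h - m \<in> polys_over A"
      using less.prems(1) ideal_subset[OF PI m] subring_diff[OF subring_polys_over[OF A]] by blast
    moreover have "(h - m) * g - [:c:] \<in> polys_over I"
    proof -
      have "(h - m) * g - [:c:] = (h * g - [:c:]) - m * g" by (simp add: algebra_simps)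
      then show ?thesis
        using ideal_diff[OF PI less.prems(2) ideal_mult_right[OF PI g(1) m]] by (simp only:)
    qed
    ultimately have "h - m \<in> polys_over I" using less.hyps by blast
    from ideal_add[OF PI this m] show ?thesis by simp
  qed
qed

text \<open>The kernel condition says that, up to powers of the leading coefficient of g, the
  evaluation at t factors through the quotient by g; the extended ideal is generated by
  I and the value of g at t.\<close>
lemma extend_ideal_to_adjoin:
  fixes g :: "'a::idom poly"
  assumes A: "is_subring A" and I: "is_ideal I A" "1 \<notin> I" "finite_residues I A"
    and g: "g \<in> polys_over A" "degree g \<ge> 1"
    and u: "u \<in> A" "lead_coeff g * u - 1 \<in> I"
    and ker: "\<And>p. p \<in> polys_over A \<Longrightarrow> poly p t = 0 \<Longrightarrow>
               \<exists>N. \<exists>s\<in>polys_over A. [:lead_coeff g ^ N:] * p = s * g"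
  shows "\<exists>J. is_ideal J (adjoin A t) \<and> 1 \<notin> J \<and> finite_residues J (adjoin A t) \<and>
           I \<subseteq> J \<and> poly g t \<in> J"
proof -
  note P = subring_polys_over[OF A] and PI = ideal_polys_over[OF I(1)]
  define l where "l = lead_coeff g"
  have l: "l \<in> A" using g by (auto simp: l_def polys_over_def)
  \<comment> \<open>Since \<open>u ^ N\<close> inverts \<open>l ^ N\<close> modulo \<open>I\<close>,
    multiplying the pseudo-division identity by it gives an honest division of \<open>p\<close> by
    \<open>g\<close> modulo I[X], with quotient \<open>[:u ^ N:] * s\<close>.\<close>
  have cancel: "\<exists>s'\<in>polys_over A. p - s' * g - [:u ^ N:] * r \<in> polys_over I"
    if "p \<in> polys_over A" "s \<in> polys_over A" "[:l ^ N:] * p = s * g + r" for p s r N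
  proof -
    have uN: "[:u ^ N:] \<in> polys_over A" using A u by (simp add: const_polys_over subring_closed)
    have "(l * u) ^ N - 1 \<in> I"
      using ideal_power_unit[OF A I(1)] u l A by (simp add: l_def subring_closed)
    then have "[:1 - (l * u) ^ N:] \<in> polys_over I"
      using ideal_uminus[OF I(1)] ideal_zero[OF I(1)] by (metis const_polys_over minus_diff_eq)
    then have "[:1 - (l * u) ^ N:] * p \<in> polys_over I"
      using ideal_mult_right[OF PI that(1)] by blast
    moreover have "[:1 - (l * u) ^ N:] * p = p - [:u ^ N:] * ([:l ^ N:] * p)"
      by (simp add: power_mult_distrib algebra_simps smult_diff_left)
    moreover have "\<dots> = p - ([:u ^ N:] * s) * g - [:u ^ N:] * r"
      unfolding that(3) by (simp only: algebra_simps)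
    ultimately show ?thesis using subring_mult[OF P uN that(2)] by metis
  qed
  \<comment> \<open>The image under evaluation at \<open>t\<close> of the ideal of A[X] generated by
    I[X] and \<open>g\<close>.\<close>
  define J where "J = (\<lambda>p. poly p t) ` {p \<in> polys_over A. \<exists>q\<in>polys_over A. p - q * g \<in> polys_over I}"
  have J: "poly p t \<in> J" if "p \<in> polys_over A" "q \<in> polys_over A" "p - q * g \<in> polys_over I" for p q
    using that unfolding J_def by blast
  have "is_ideal J (adjoin A t)"
    unfolding is_ideal_def
  proof (intro conjI ballI)
    show "J \<subseteq> adjoin A t" by (auto simp: J_def adjoin_def)
    show "0 \<in> J" using J[of 0 0] ideal_zero[OF PI] subring_zero[OF P] by simp
  next
    fix x y assume "x \<in> J" "y \<in> J"
    then obtain p q p' q' where *: "x = poly p t" "y = poly p' t" "p \<in> polys_over A" "p' \<in> polys_over A"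
      "q \<in> polys_over A" "q' \<in> polys_over A" "p - q * g \<in> polys_over I" "p' - q' * g \<in> polys_over I"
      unfolding J_def by blast
    have "(p - p') - (q - q') * g = (p - q * g) - (p' - q' * g)" by (simp add: algebra_simps)
    then have "poly (p - p') t \<in> J"
      using * subring_diff[OF P] ideal_diff[OF PI] by (intro J[of _ "q - q'"]) metis+
    then show "x - y \<in> J" using * by simp
  next
    fix a x assume "a \<in> adjoin A t" "x \<in> J"
    then obtain p q p' where *: "x = poly p t" "a = poly p' t" "p \<in> polys_over A" "p' \<in> polys_over A"
      "q \<in> polys_over A" "p - q * g \<in> polys_over I"
      unfolding J_def adjoin_def by blast
    have "p' * p - (p' * q) * g = p' * (p - q * g)" by (simp add: algebra_simps)
    then have "poly (p' * p) t \<in> J"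
      using * subring_mult[OF P] ideal_mult[OF PI] by (intro J[of _ "p' * q"]) metis+
    then show "a * x \<in> J" using * by simp
  qed
  moreover have "1 \<notin> J"
  proof
    assume "1 \<in> J"
    then obtain p q where pq: "poly p t = 1" "p \<in> polys_over A" "q \<in> polys_over A"
      "p - q * g \<in> polys_over I" unfolding J_def by force
    \<comment> \<open>If 1 lies in \<open>J\<close>, then \<open>p - 1\<close> vanishes at
      \<open>t\<close>, so by \<open>ker\<close> and \<open>cancel\<close> it is a multiple of
      \<open>g\<close> modulo I[X]. As \<open>p\<close> is one too, so is the constant 1, which
      forces 1 into \<open>I\<close>.\<close>
    have p1: "p - 1 \<in> polys_over A" using pq subring_closed[OF P] by blast
    then obtain N s where "s \<in> polys_over A" "[:l ^ N:] * (p - 1) = s * g + 0"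
      using ker[of "p - 1"] pq unfolding l_def by auto
    from cancel[OF p1 this] obtain s' where s': "s' \<in> polys_over A" "p - 1 - s' * g \<in> polys_over I"
      by auto
    have "(p - 1 - s' * g) - (p - q * g) = (q - s') * g - [:1:]"
      by (simp add: algebra_simps one_pCons)
    then have h: "(q - s') * g - [:1:] \<in> polys_over I"
      using ideal_diff[OF PI s'(2) pq(4)] by simp
    have "q - s' \<in> polys_over I"
      by (rule multiple_congruent_const_imp_zero[OF A I(1) g u _ h]) (use pq s' subring_diff[OF P] in blast)
    from ideal_diff[OF PI ideal_mult_right[OF PI g(1) this] h]
    have "[:1:] \<in> polys_over I" by simp
    then have "1 \<in> I" unfolding polys_over_def by (metis (mono_tags) coeff_pCons_0 mem_Collect_eq)
    with I show False by simp
  qed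
  moreover have "finite_residues J (adjoin A t)"
  proof -
    obtain F where F: "finite F" "F \<subseteq> A" "\<And>x. x \<in> A \<Longrightarrow> \<exists>f\<in>F. x - f \<in> I"
      using I(3) unfolding finite_residues_def by blast
    \<comment> \<open>Coefficient lists for the polynomials of degree below \<open>degree g\<close>
      with coefficients among the representatives \<open>F\<close>. Their values at \<open>t\<close>
      will represent all of A[t] modulo \<open>J\<close>.\<close>
    define L where "L = {xs. set xs \<subseteq> F \<and> length xs = degree g}"
    have over: "Poly xs \<in> polys_over A" if "xs \<in> L" for xs
    proof -
      have "xs ! i \<in> A" if "i < length xs" for i
        using nth_mem[OF that] \<open>xs \<in> L\<close> F(2) by (auto simp: L_def)
      then show ?thesis using subring_zero[OF A] by (auto simp: polys_over_def nth_default_def)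
    qed
    have "finite ((\<lambda>xs. poly (Poly xs) t) ` L)"
      unfolding L_def by (intro finite_imageI finite_lists_length_eq F)
    moreover have "(\<lambda>xs. poly (Poly xs) t) ` L \<subseteq> adjoin A t"
      using over by (auto simp: adjoin_def)
    moreover have "\<exists>f\<in>(\<lambda>xs. poly (Poly xs) t) ` L. x - f \<in> J" if x: "x \<in> adjoin A t" for x
    proof -
      obtain p where p: "p \<in> polys_over A" "x = poly p t" using x by (auto simp: adjoin_def)
      obtain N s r where sr: "s \<in> polys_over A" "r \<in> polys_over A" "degree r < degree g"
        "[:l ^ N:] * p = s * g + r"
        using pseudo_division_over_subring[OF A g p(1)] unfolding l_def by blast
      obtain s' where s': "s' \<in> polys_over A" "p - s' * g - [:u ^ N:] * r \<in> polys_over I"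
        using cancel[OF p(1) sr(1,4)] by blast
      define r' where "r' = [:u ^ N:] * r"
      have "[:u ^ N:] \<in> polys_over A" using A u by (simp add: const_polys_over subring_closed)
      then have r': "r' \<in> polys_over A" unfolding r'_def using sr subring_mult[OF P] by blast
      have dr': "degree r' < degree g"
        unfolding r'_def using sr(3) degree_smult_le[of "u ^ N" r] by simp
      obtain \<rho> where \<rho>: "\<And>y. y \<in> A \<Longrightarrow> \<rho> y \<in> F \<and> y - \<rho> y \<in> I" using F(3) by metis
      \<comment> \<open>The remainder with each coefficient replaced by its representative modulo
        \<open>I\<close>.\<close>
      define xs where "xs = map (\<lambda>i. \<rho> (coeff r' i)) [0..<degree g]"
      have xs: "xs \<in> L" using r' \<rho> by (auto simp: L_def xs_def polys_over_def)
      have "r' - Poly xs \<in> polys_over I"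
        unfolding polys_over_def
      proof (clarify)
        fix i show "coeff (r' - Poly xs) i \<in> I"
          using r' \<rho> dr' ideal_zero[OF I(1)]
          by (cases "i < degree g")
            (auto simp: xs_def nth_default_def polys_over_def coeff_eq_0)
      qed
      from ideal_add[OF PI s'(2)[folded r'_def] this]
      have "(p - Poly xs) - s' * g \<in> polys_over I"
        by (simp add: diff_diff_eq add.commute)
      then have "poly (p - Poly xs) t \<in> J"
        using s' p over[OF xs] by (intro J[of _ s'] subring_diff[OF P]) auto
      with xs p show ?thesis by auto
    qed
    ultimately show ?thesis unfolding finite_residues_def
      by (intro exI[of _ "(\<lambda>xs. poly (Poly xs) t) ` L"] conjI ballI)
  qed
  moreover have "I \<subseteq> J"
  proof
    fix x assume "x \<in> I"
    then have "[:x:] \<in> polys_over I" using ideal_zero[OF I(1)] by (simp add: const_polys_over)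
    then show "x \<in> J" using J[of "[:x:]" 0] ideal_subset[OF PI] subring_zero[OF P] by simp
  qed
  moreover have "poly g t \<in> J"
    using J[of g 1] g subring_one[OF P] ideal_zero[OF PI] by simp
  ultimately show ?thesis by blast
qed

section \<open>Nonzero multiples in the base ring when t is algebraic\<close>

lemma degree_ge_1_of_root:
  fixes p :: "'a::comm_semiring_0 poly"
  assumes "p \<noteq> 0" "poly p t = 0" shows "degree p \<ge> 1"
proof (rule ccontr)
  assume "\<not> degree p \<ge> 1"
  then obtain c where "p = [:c:]" by (metis degree_eq_zeroE less_one linorder_not_le)
  with assms show False by auto
qed

text \<open>Euclid's algorithm, in the form of a minimality argument.\<close>
lemma multiple_in_base_ring:
  fixes g :: "'a::idom poly"
  assumes A: "is_subring A" and g: "g \<in> polys_over A" "g \<noteq> 0" "poly g t = 0"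
    and min: "\<And>p. p \<in> polys_over A \<Longrightarrow> p \<noteq> 0 \<Longrightarrow> poly p t = 0 \<Longrightarrow> degree g \<le> degree p"
    and b: "b \<in> adjoin A t" "b \<noteq> 0"
  shows "\<exists>a\<in>A. a \<noteq> 0 \<and> (\<exists>b'\<in>adjoin A t. a = b * b')"
proof -
  note P = subring_polys_over[OF A] and B = subring_adjoin[OF A, of t]
  \<comment> \<open>The polynomials whose value at \<open>t\<close> is a nonzero multiple of
    \<open>b\<close> in A[t]. A member of least degree will turn out to be constant, and its
    constant is the required \<open>a\<close>.\<close>
  define S where "S = {q \<in> polys_over A. poly q t \<noteq> 0 \<and> (\<exists>b'\<in>adjoin A t. poly q t = b * b')}"
  obtain p where "p \<in> polys_over A" "poly p t = b" using b by (auto simp: adjoin_def)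
  then have "p \<in> S" using b subring_one[OF B] by (auto simp: S_def intro!: bexI[of _ 1])
  define q where "q = arg_min degree (\<lambda>q. q \<in> S)"
  have q: "q \<in> S" and qmin: "\<And>q'. q' \<in> S \<Longrightarrow> degree q \<le> degree q'"
    using arg_min_nat_lemma[of "\<lambda>q. q \<in> S" p degree] \<open>p \<in> S\<close> by (auto simp: q_def)
  obtain b' where b': "b' \<in> adjoin A t" "poly q t = b * b'" and qA: "q \<in> polys_over A"
    and qt: "poly q t \<noteq> 0" using q by (auto simp: S_def)
  have dg: "degree g \<ge> 1" using g degree_ge_1_of_root by blast
  \<comment> \<open>Reducing \<open>q\<close> modulo \<open>g\<close> only scales the value at
    \<open>t\<close> by a nonzero factor, so the remainder stays in \<open>S\<close>.\<close>
  have le: "degree q \<le> degree g"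
  proof -
    obtain N s r where sr: "s \<in> polys_over A" "r \<in> polys_over A" "degree r < degree g"
      "[:lead_coeff g ^ N:] * q = s * g + r"
      using pseudo_division_over_subring[OF A g(1) dg qA] by auto
    have "lead_coeff g ^ N \<in> A" using A g by (auto simp: polys_over_def intro: subring_power)
    then have lN: "lead_coeff g ^ N \<in> adjoin A t" using subset_adjoin[OF A] by blast
    have "poly ([:lead_coeff g ^ N:] * q) t = poly r t" unfolding sr(4) using g by simp
    then have rt: "poly r t = lead_coeff g ^ N * poly q t" by simp
    then have "poly r t = b * (lead_coeff g ^ N * b')" using b' by simp
    moreover have "poly r t \<noteq> 0" using rt qt g by simp
    moreover have "lead_coeff g ^ N * b' \<in> adjoin A t" using lN b' B subring_mult by blast
    ultimately have "r \<in> S" using sr unfolding S_def by blast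
    with qmin sr(3) show ?thesis by force
  qed
  \<comment> \<open>Otherwise divide \<open>g\<close> by \<open>q\<close>. The value of the
    remainder at \<open>t\<close> is a multiple of \<open>b\<close>, hence zero by minimality of
    \<open>q\<close>, and then the remainder itself is zero by minimality of \<open>g\<close>. So a
    nonzero scalar multiple of \<open>g\<close> equals \<open>s * q\<close>, where \<open>s\<close>
    vanishes at \<open>t\<close> and has smaller degree than \<open>g\<close>, a
    contradiction.\<close>
  have "degree q = 0"
  proof (rule ccontr)
    assume dq: "degree q \<noteq> 0"
    obtain N s r where sr: "s \<in> polys_over A" "r \<in> polys_over A" "degree r < degree q"
      "[:lead_coeff q ^ N:] * g = s * q + r"
      using pseudo_division_over_subring[OF A qA _ g(1)] dq by auto
    have st: "poly s t \<in> adjoin A t" using sr by (auto simp: adjoin_def)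
    have "poly ([:lead_coeff q ^ N:] * g) t = 0" using g by simp
    then have rt0: "poly r t = - (poly s t * poly q t)" unfolding sr(4)
      by (simp add: add_eq_0_iff)
    then have rt: "poly r t = b * - (poly s t * b')" using b' by simp
    have "- (poly s t * b') \<in> adjoin A t" using st b' B by (simp add: subring_closed)
    then have r0: "poly r t = 0" using qmin[of r] sr(2,3) rt unfolding S_def
      by (metis (mono_tags, lifting) linorder_not_le mem_Collect_eq)
    then have "r = 0" using min[OF sr(2)] sr(3) le by fastforce
    have "[:lead_coeff q ^ N:] * g \<noteq> 0" using g dq by auto
    then have sq: "s * q \<noteq> 0" unfolding sr(4) \<open>r = 0\<close> by simp
    have "degree g = degree ([:lead_coeff q ^ N:] * g)" using dq by auto
    also have "\<dots> = degree s + degree q" using sr(4) \<open>r = 0\<close> sq by (simp add: degree_mult_eq)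
    finally have "degree s < degree g" using dq by simp
    moreover have "poly s t = 0" using rt0 r0 qt by simp
    ultimately show False using min[OF sr(1)] sq by fastforce
  qed
  then obtain a where a: "q = [:a:]" by (rule degree_eq_zeroE)
  have "a \<in> A" using qA a unfolding polys_over_def by (metis (mono_tags) coeff_pCons_0 mem_Collect_eq)
  moreover have "a = b * b'" "a \<noteq> 0" using a b' qt by auto
  ultimately show ?thesis using b' by blast
qed

section \<open>The Nullstellensatz over the integers, by induction on the generators\<close>

text \<open>In both cases an ideal of \<open>A\<close> modulo which a suitable leading coefficient
  is a unit is extended to A[t]. If \<open>t\<close> is transcendental over \<open>A\<close>, the
  extension also contains an element that forces \<open>b\<close> to be invertible; if
  \<open>t\<close> is algebraic, \<open>b\<close> divides a nonzero element of \<open>A\<close> that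
  can be inverted already in \<open>A\<close>.\<close>

lemma finite_quotients_detect_nonzero_adjoin:
  fixes A :: "'a::idom set"
  assumes A: "is_subring A" and D: "finite_quotients_detect_nonzero A"
  shows "finite_quotients_detect_nonzero (adjoin A t)"
  unfolding finite_quotients_detect_nonzero_def
proof (intro ballI impI)
  fix b assume b: "b \<in> adjoin A t" "b \<noteq> 0"
  note P = subring_polys_over[OF A] and B = subring_adjoin[OF A, of t]
  define Z where "Z = {p \<in> polys_over A. p \<noteq> 0 \<and> poly p t = 0}"
  show "\<exists>J. is_ideal J (adjoin A t) \<and> 1 \<notin> J \<and> finite_residues J (adjoin A t) \<and>
           (\<exists>u\<in>adjoin A t. b * u - 1 \<in> J)"
  proof (cases "Z = {}")
    case True
    obtain p where p: "p \<in> polys_over A" "poly p t = b" using b by (auto simp: adjoin_def)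
    have pn: "p \<noteq> 0" using p b by auto
    \<comment> \<open>t is transcendental over A: modulo 1 + t b, the element b is invertible with inverse -t.\<close>
    define g where "g = 1 + monom 1 1 * p"
    have X: "monom 1 1 \<in> polys_over A" using A by (simp add: monom_polys_over subring_closed)
    have g: "g \<in> polys_over A" unfolding g_def using P X p by (simp add: subring_closed)
    have "degree (monom 1 1 * p) = Suc (degree p)" using pn by (simp add: degree_mult_eq degree_monom_eq)
    then have dg: "degree g = Suc (degree p)" unfolding g_def
      by (subst degree_add_eq_right) auto
    then have "g \<noteq> 0" by auto
    then have lg: "lead_coeff g \<in> A" "lead_coeff g \<noteq> 0" using g by (auto simp: polys_over_def)
    then obtain I u where I: "is_ideal I A" "1 \<notin> I" "finite_residues I A" "u \<in> A" "lead_coeff g * u - 1 \<in> I"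
      using D unfolding finite_quotients_detect_nonzero_def by blast
    have "\<exists>J. is_ideal J (adjoin A t) \<and> 1 \<notin> J \<and> finite_residues J (adjoin A t) \<and> I \<subseteq> J \<and> poly g t \<in> J"
    proof (rule extend_ideal_to_adjoin[OF A I(1-3) g _ I(4,5)])
      fix q assume "q \<in> polys_over A" "poly q t = 0"
      then have "q = 0" using True by (auto simp: Z_def)
      then show "\<exists>N. \<exists>s\<in>polys_over A. [:lead_coeff g ^ N:] * q = s * g"
        using subring_zero[OF P] by auto
    qed (use dg in simp)
    then obtain J where J: "is_ideal J (adjoin A t)" "1 \<notin> J" "finite_residues J (adjoin A t)" "poly g t \<in> J"
      by blast
    have "- poly g t = b * (- t) - 1" unfolding g_def using p by (simp add: poly_monom algebra_simps)
    then have "b * (- t) - 1 \<in> J" using ideal_uminus[OF J(1,4)] by simp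
    moreover have "- t \<in> adjoin A t" using mem_adjoin[OF A] subring_uminus[OF B] by blast
    ultimately show ?thesis using J by blast
  next
    case False
    \<comment> \<open>Up to a scalar this is the minimal polynomial of \<open>t\<close> over the
      fraction field of \<open>A\<close>.\<close>
    define g where "g = arg_min degree (\<lambda>p. p \<in> Z)"
    have gZ: "g \<in> Z" and gmin: "\<And>p. p \<in> Z \<Longrightarrow> degree g \<le> degree p"
      using False arg_min_nat_lemma[of "\<lambda>p. p \<in> Z" _ degree] by (auto simp: g_def)
    then have g: "g \<in> polys_over A" "g \<noteq> 0" "poly g t = 0" by (auto simp: Z_def)
    have dg: "degree g \<ge> 1" using g degree_ge_1_of_root by blast
    obtain a b' where a: "a \<in> A" "a \<noteq> 0" "b' \<in> adjoin A t" "a = b * b'"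
      using multiple_in_base_ring[OF A g _ b] gmin by (auto simp: Z_def)
    define l where "l = lead_coeff g"
    have l: "l \<in> A" "l \<noteq> 0" using g by (auto simp: l_def polys_over_def)
    \<comment> \<open>One ideal has to serve two purposes: inverting \<open>l\<close> allows the
      extension to A[t], and inverting \<open>a\<close> makes its divisor \<open>b\<close>
      invertible.\<close>
    then have "a * l \<in> A" "a * l \<noteq> 0" using a A by (auto intro: subring_mult)
    then obtain I u where I: "is_ideal I A" "1 \<notin> I" "finite_residues I A" "u \<in> A" "a * l * u - 1 \<in> I"
      using D unfolding finite_quotients_detect_nonzero_def by blast
    have au: "a * u \<in> A" "lead_coeff g * (a * u) - 1 \<in> I"
      using subring_mult[OF A a(1) I(4)] I(5) by (simp_all add: l_def mult_ac)
    have "\<exists>J. is_ideal J (adjoin A t) \<and> 1 \<notin> J \<and> finite_residues J (adjoin A t) \<and> I \<subseteq> J \<and> poly g t \<in> J"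
    proof (rule extend_ideal_to_adjoin[OF A I(1-3) g(1) dg au])
      fix q assume q: "q \<in> polys_over A" "poly q t = 0"
      obtain N s r where sr: "s \<in> polys_over A" "r \<in> polys_over A" "degree r < degree g"
        "[:lead_coeff g ^ N:] * q = s * g + r"
        using pseudo_division_over_subring[OF A g(1) dg q(1)] by auto
      have "poly ([:lead_coeff g ^ N:] * q) t = poly r t" unfolding sr(4) using g by simp
      then have "poly r t = 0" using q by simp
      \<comment> \<open>The remainder vanishes at \<open>t\<close> and has smaller degree than
        \<open>g\<close>, so minimality of \<open>g\<close> leaves only zero.\<close>
      then have "r = 0" using gmin[of r] sr by (auto simp: Z_def)
      then show "\<exists>N. \<exists>s\<in>polys_over A. [:lead_coeff g ^ N:] * q = s * g"
        using sr by auto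
    qed
    then obtain J where J: "is_ideal J (adjoin A t)" "1 \<notin> J" "finite_residues J (adjoin A t)" "I \<subseteq> J"
      by blast
    have "b * (b' * (l * u)) - 1 \<in> J" using I J a by (auto simp: algebra_simps)
    moreover have "b' * (l * u) \<in> adjoin A t"
      using a l I subset_adjoin[OF A] by (meson B subring_mult subsetD)
    ultimately show ?thesis using J by blast
  qed
qed

lemma subring_Ints: "is_subring (\<int> :: 'a::comm_ring_1 set)"
  by (auto simp: is_subring_def)

lemma finite_quotients_detect_nonzero_Ints:
  "finite_quotients_detect_nonzero (\<int> :: 'a::{comm_ring_1,ring_char_0} set)"
  unfolding finite_quotients_detect_nonzero_def
proof (intro ballI impI)
  fix a :: 'a assume "a \<in> \<int>" "a \<noteq> 0"
  then obtain k where k: "a = of_int k" "k \<noteq> 0" by (auto elim: Ints_cases)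
  \<comment> \<open>Modulo \<open>3 * k + 1\<close> the inverse of \<open>k\<close> is -3. The
    factor 3 keeps \<open>n\<close> away from 0, 1 and -1 for every nonzero \<open>k\<close>, while
    \<open>k + 1\<close> and \<open>2 * k + 1\<close> fail at \<open>k = -1\<close>.\<close>
  define n where "n = 3 * k + 1"
  have n: "\<bar>n\<bar> \<ge> 2" using k unfolding n_def by linarith
  define I where "I = range (\<lambda>j. of_int (n * j) :: 'a)"
  have "is_ideal I \<int>"
    unfolding is_ideal_def
  proof (intro conjI ballI)
    show "I \<subseteq> \<int>" by (auto simp: I_def simp del: of_int_mult)
    show "0 \<in> I" unfolding I_def by (rule range_eqI[of _ _ 0]) simp
  next
    fix x y assume "x \<in> I" "y \<in> I"
    then obtain i j where "x = of_int (n * i)" "y = of_int (n * j)" by (auto simp: I_def)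
    then show "x - y \<in> I" unfolding I_def by (intro range_eqI[of _ _ "i - j"]) (simp add: algebra_simps)
  next
    fix a x :: 'a assume "a \<in> \<int>" "x \<in> I"
    then obtain i j where "a = of_int i" "x = of_int (n * j)" by (auto simp: I_def elim: Ints_cases)
    then show "a * x \<in> I" unfolding I_def by (intro range_eqI[of _ _ "i * j"]) (simp add: algebra_simps)
  qed
  moreover have "1 \<notin> I"
  proof
    assume "1 \<in> I"
    then obtain j where "(of_int 1 :: 'a) = of_int (n * j)" unfolding I_def by auto
    then have "1 = n * j" by (simp only: of_int_eq_iff)
    then have "n dvd 1" by (rule dvdI)
    with n show False by simp
  qed
  moreover have "finite_residues I \<int>"
    unfolding finite_residues_def
  \<comment> \<open>The interval is symmetric because \<open>i mod n\<close> takes the sign of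
    \<open>n\<close>, which may be negative.\<close>
  proof (intro exI[of _ "of_int ` {-\<bar>n\<bar>..\<bar>n\<bar>}"] conjI ballI)
    fix x :: 'a assume "x \<in> \<int>"
    then obtain i where i: "x = of_int i" by (auto elim: Ints_cases)
    have "i - i mod n = n * (i div n)" by (simp add: minus_mod_eq_mult_div)
    then have "x - of_int (i mod n) \<in> I"
      unfolding I_def i of_int_diff[symmetric] by (intro range_eqI) auto
    moreover have "i mod n \<in> {-\<bar>n\<bar>..\<bar>n\<bar>}"
    proof -
      have "\<bar>i mod n\<bar> < \<bar>n\<bar>" using n by (intro abs_mod_less) auto
      then show ?thesis by auto
    qed
    ultimately show "\<exists>f\<in>of_int ` {-\<bar>n\<bar>..\<bar>n\<bar>}. x - f \<in> I" by blast
  qed auto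
  moreover have "a * (- 3) - 1 \<in> I"
    unfolding I_def k n_def by (rule range_eqI[of _ _ "-1"]) simp
  moreover have "(- 3 :: 'a) \<in> \<int>" by simp
  ultimately show "\<exists>I. is_ideal I \<int> \<and> 1 \<notin> I \<and> finite_residues I \<int> \<and> (\<exists>u\<in>\<int>. a * u - 1 \<in> I)"
    by blast
qed

text \<open>The ring is built from the integers by adjoining the elements of \<open>S\<close> one at
  a time; each adjunction preserves the property.\<close>

lemma finite_set_in_detecting_subring:
  fixes S :: "'a::{idom,ring_char_0} set"
  assumes "finite S"
  shows "\<exists>A. is_subring A \<and> S \<subseteq> A \<and> finite_quotients_detect_nonzero A"
  using assms
proof (induction S)
  case empty
  then show ?case using subring_Ints finite_quotients_detect_nonzero_Ints by blast
next
  case (insert t S)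
  then obtain A where A: "is_subring A" "S \<subseteq> A" "finite_quotients_detect_nonzero A" by blast
  then have "insert t S \<subseteq> adjoin A t" using subset_adjoin[of A t] mem_adjoin[of A t] by blast
  then show ?case using A subring_adjoin finite_quotients_detect_nonzero_adjoin by blast
qed

section \<open>Characters and the subgroup of finite index\<close>

lemma chr_add:
  assumes "z \<in> Tr r" shows "chr r (\<lambda>k. a k + b k) z = chr r a z * chr r b z"
proof -
  have "z k powi (a k + b k) = z k powi a k * z k powi b k" if "k < r" for k
  proof -
    have "z k \<noteq> 0" using assms that by (auto simp: Tr_def)
    then show ?thesis by (simp add: power_int_add)
  qed
  then show ?thesis by (simp add: chr_def prod.distrib)
qed

lemma chr_zero: "chr r (\<lambda>k. 0) z = 1"
  by (simp add: chr_def)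

lemma chr_in_subring:
  assumes "is_subring A" "\<And>k. k < r \<Longrightarrow> z k \<in> A \<and> inverse (z k) \<in> A"
  shows "chr r a z \<in> A"
  unfolding chr_def
  using assms by (auto simp: power_int_def intro!: subring_prod subring_power)

theorem theorem3p5:
  fixes r :: nat and K :: "(nat \<Rightarrow> int) set"
  assumes "K \<subseteq> Zr r" and "ubiquitous r K"
  shows "strictly_pos_def r K"
  unfolding strictly_pos_def_def
proof (intro allI impI ballI, rule ccontr)
  fix n c x \<gamma>
  assume x: "\<forall>i<n. x i \<in> Tr r" and van: "\<forall>\<gamma>\<in>K. trig_poly r n c x \<gamma> = 0"
    and \<gamma>: "\<gamma> \<in> Zr r" and nz: "trig_poly r n c x \<gamma> \<noteq> 0"
  \<comment> \<open>The inverses of the coordinates are included because the exponents of a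
    character may be negative.\<close>
  define S where "S = c ` {..<n} \<union> (\<lambda>(i, k). x i k) ` ({..<n} \<times> {..<r}) \<union>
    (\<lambda>(i, k). inverse (x i k)) ` ({..<n} \<times> {..<r})"
  have "finite S" unfolding S_def by auto
  then obtain A where A: "is_subring A" "S \<subseteq> A" "finite_quotients_detect_nonzero A"
    using finite_set_in_detecting_subring by blast
  have cA: "c i \<in> A" if "i < n" for i using A that by (auto simp: S_def)
  have chrA: "chr r a (x i) \<in> A" if "i < n" for a i
    using A that by (intro chr_in_subring) (auto simp: S_def)
  have "trig_poly r n c x \<gamma> \<in> A"
    unfolding trig_poly_def using A cA chrA by (auto intro!: subring_sum subring_mult)
  then obtain I u where I: "is_ideal I A" "1 \<notin> I" "finite_residues I A" "u \<in> A"
    "trig_poly r n c x \<gamma> * u - 1 \<in> I"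
    using A nz unfolding finite_quotients_detect_nonzero_def by blast
  define H where "H = {a \<in> Zr r. \<forall>i<n. chr r a (x i) - 1 \<in> I}"
  have "subgroup_Zr r H"
    unfolding subgroup_Zr_def
  proof (intro conjI ballI)
    show "H \<subseteq> Zr r" by (auto simp: H_def)
    show "(\<lambda>k. 0) \<in> H" using ideal_zero[OF I(1)] by (auto simp: H_def Zr_def chr_zero)
  next
    fix a b assume ab: "a \<in> H" "b \<in> H"
    have "chr r (\<lambda>k. a k + b k) (x i) - 1 \<in> I" if i: "i < n" for i
    proof -
      have *: "chr r (\<lambda>k. a k + b k) (x i) - 1 =
          chr r a (x i) * (chr r b (x i) - 1) + (chr r a (x i) - 1)"
        using x i by (simp add: chr_add algebra_simps)
      show ?thesis unfolding * using ab i chrA[OF i]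
        by (auto simp: H_def intro!: ideal_add[OF I(1)] ideal_mult[OF I(1)])
    qed
    then show "(\<lambda>k. a k + b k) \<in> H" using ab by (auto simp: H_def Zr_def)
  next
    fix a assume a: "a \<in> H"
    have "chr r (\<lambda>k. - a k) (x i) - 1 \<in> I" if i: "i < n" for i
    proof -
      \<comment> \<open>The values of characters are units of \<open>A\<close>, so the congruence to
        1 passes to inverses.\<close>
      have "chr r (\<lambda>k. - a k) (x i) * chr r a (x i) = 1"
        using chr_add[of "x i" r "\<lambda>k. - a k" a] x i by (simp add: chr_zero)
      then have "chr r (\<lambda>k. - a k) (x i) - 1 = - (chr r (\<lambda>k. - a k) (x i) * (chr r a (x i) - 1))"
        by (simp add: algebra_simps)
      then show ?thesis using a i chrA[OF i]
        by (auto simp only: H_def mem_Collect_eq intro!: ideal_uminus[OF I(1)] ideal_mult[OF I(1)])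
    qed
    then show "(\<lambda>k. - a k) \<in> H" using a by (auto simp: H_def Zr_def)
  qed
  moreover have "finite_index r H"
  proof -
    obtain F where F: "finite F" "\<And>y. y \<in> A \<Longrightarrow> \<exists>f\<in>F. y - f \<in> I"
      using I(3) unfolding finite_residues_def by blast
    then obtain \<rho> where \<rho>: "\<And>y. y \<in> A \<Longrightarrow> \<rho> y \<in> F \<and> y - \<rho> y \<in> I" by metis
    \<comment> \<open>\<open>R a\<close> records the residues modulo \<open>I\<close> of all
      \<open>n\<close> character values at \<open>a\<close>. Only finitely many records occur, and
      equal records will give equal cosets.\<close>
    define R where "R a = map (\<lambda>i. \<rho> (chr r a (x i))) [0..<n]" for a
    have "R ` Zr r \<subseteq> {xs. set xs \<subseteq> F \<and> length xs = n}" using \<rho> chrA by (auto simp: R_def)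
    then have fin: "finite (R ` Zr r)" using F(1) finite_lists_length_eq finite_subset by blast
    have sub: "coset a H \<subseteq> coset b H" if ab: "a \<in> Zr r" "b \<in> Zr r" "R a = R b" for a b
    proof
      fix y assume "y \<in> coset a H"
      then obtain h where h: "h \<in> H" "y = (\<lambda>k. a k + h k)" by (auto simp: coset_def)
      define d where "d = (\<lambda>k. a k - b k)"
      have "chr r d (x i) - 1 \<in> I" if i: "i < n" for i
      proof -
        have "\<rho> (chr r a (x i)) = \<rho> (chr r b (x i))" using ab(3) i by (auto simp: R_def)
        then have "chr r a (x i) - chr r b (x i) =
            (chr r a (x i) - \<rho> (chr r a (x i))) - (chr r b (x i) - \<rho> (chr r b (x i)))" by simp
        then have "chr r a (x i) - chr r b (x i) \<in> I"
          using \<rho> chrA[OF i] ideal_diff[OF I(1)] by metis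
        \<comment> \<open>Multiplying by the inverse of the value at \<open>b\<close> turns the
          congruence of the two values into the congruence of the value at \<open>d\<close> to
          1.\<close>
        then have "chr r (\<lambda>k. - b k) (x i) * (chr r a (x i) - chr r b (x i)) \<in> I"
          using chrA[OF i] ideal_mult[OF I(1)] by blast
        moreover have "chr r (\<lambda>k. - b k) (x i) * chr r b (x i) = 1"
          using chr_add[of "x i" r "\<lambda>k. - b k" b] x i by (simp add: chr_zero)
        moreover have "chr r (\<lambda>k. - b k) (x i) * chr r a (x i) = chr r d (x i)"
          using chr_add[of "x i" r "\<lambda>k. - b k" a] x i by (simp add: d_def)
        ultimately show ?thesis by (simp add: right_diff_distrib)
      qed
      then have "d \<in> H" using ab by (auto simp: H_def Zr_def d_def)
      then have "(\<lambda>k. d k + h k) \<in> H" using \<open>subgroup_Zr r H\<close> h unfolding subgroup_Zr_def by blast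
      moreover have "y = (\<lambda>k. b k + (d k + h k))" unfolding h d_def by auto
      ultimately show "y \<in> coset b H" unfolding coset_def mem_Collect_eq
        by (intro exI[of _ "\<lambda>k. d k + h k"] conjI)
    qed
    then have "coset a H = coset b H" if "a \<in> Zr r" "b \<in> Zr r" "R a = R b" for a b
      using that by (metis subset_antisym)
    \<comment> \<open>A coset is determined by the record of any of its representatives, so choosing
      one representative per record reaches every coset.\<close>
    then have "(\<lambda>a. coset a H) ` Zr r \<subseteq> (\<lambda>v. coset (inv_into (Zr r) R v) H) ` R ` Zr r"
      by (smt (verit) f_inv_into_f image_eqI image_subsetI inv_into_into)
    then show ?thesis unfolding finite_index_def using fin finite_surj by blast
  qed
  ultimately have "coset \<gamma> H \<inter> K \<noteq> {}" using assms(2) \<gamma> unfolding ubiquitous_def by blast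
  then obtain h where h: "h \<in> H" "(\<lambda>k. \<gamma> k + h k) \<in> K" by (auto simp: coset_def)
  \<comment> \<open>Moving by an element of \<open>H\<close> changes the polynomial only by an
    element of \<open>I\<close>. At the point of \<open>K\<close> its value is 0, so its value at
    \<open>\<gamma>\<close> lies in \<open>I\<close>, although it is invertible modulo the proper
    ideal \<open>I\<close>.\<close>
  have "trig_poly r n c x (\<lambda>k. \<gamma> k + h k) - trig_poly r n c x \<gamma> =
      (\<Sum>i<n. c i * chr r \<gamma> (x i) * (chr r h (x i) - 1))"
    unfolding trig_poly_def sum_subtractf[symmetric]
    using x by (intro sum.cong) (auto simp: chr_add algebra_simps)
  also have "\<dots> \<in> I"
    using h(1) cA chrA A by (auto simp: H_def intro!: ideal_sum[OF I(1)] ideal_mult[OF I(1)] subring_mult)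
  finally have "- trig_poly r n c x \<gamma> \<in> I" using van h by simp
  then have "trig_poly r n c x \<gamma> \<in> I" using ideal_uminus[OF I(1)] by fastforce
  then have "trig_poly r n c x \<gamma> * u - (trig_poly r n c x \<gamma> * u - 1) \<in> I"
    by (rule ideal_diff[OF I(1) ideal_mult_right[OF I(1,4)] I(5)])
  then show False using I by simp
qed

end
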